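(* Let $d_{\mathfrak a},d_{\mathfrak b}$ be positive integers and let $\mathfrak{a}=(a_n)_{n\ge 0}$ and $\mathfrak{b}=(b_n)_{n\ge 0}$ be sequences in $\mathbb{C}$ such that their generating series are of the form $$\sum_{n\ge 0}a_nt^n=\frac{h_0(\mathfrak a)+\cdots+h_{d_{\mathfrak a}-1}(\mathfrak a)t^{d_{\mathfrak a}-1}}{(1-t)^{d_{\mathfrak a}}},\qquad \sum_{n\ge 0}b_nt^n=\frac{h_0(\mathfrak b)+\cdots+h_{d_{\mathfrak b}-1}(\mathfrak b)t^{d_{\mathfrak b}-1}}{(1-t)^{d_{\mathfrak b}}}.$$ If $d_{\mathfrak a}\le d_{\mathfrak b}$, then $$h_n(\mathfrak a\ast\mathfrak b)=\begin{cases}\operatorname{rev}_{n,d_{\mathfrak a}}(\mathfrak h(\mathfrak a))^T\cdot M_{d_{\mathfrak a}}(d_{\mathfrak b},0)\cdot \operatorname{rev}_{n,d_{\mathfrak a}}(\mathfrak h(\mathfrak b)), & \text{if } 0\le n\le d_{\mathfrak a}-1,\\ \operatorname{rev}_{d_{\mathfrak a}-1,d_{\mathfrak a}}(\mathfrak h(\mathfrak a))^T\cdot M_{d_{\mathfrak a}}(d_{\mathfrak b},n-d_{\mathfrak a}+1)\cdot \operatorname{rev}_{n,d_{\mathfrak a}}(\mathfrak h(\mathfrak b)), & \text{if } d_{\mathfrak a}\le n\le d_{\mathfrak b}-1,\\ \operatorname{rev}_{n-d_{\mathfrak b}+d_{\mathfrak a},d_{\mathfrak a}}(\mathfrak h(\mathfrak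 a))^T\cdot M_{d_{\mathfrak a}}(d_{\mathfrak b},d_{\mathfrak b}-d_{\mathfrak a})\cdot \operatorname{rev}_{n,d_{\mathfrak a}}(\mathfrak h(\mathfrak b)), & \text{if } d_{\mathfrak b}\le n\le d_{\mathfrak a}+d_{\mathfrak b}-1.\end{cases}$$
   Context: Binomial coefficients: for $x\in\mathbb{C}$ and $k\in\mathbb{Z}$, $\binom{x}{k}=\frac{x(x-1)\cdots(x-k+1)}{k!}$ if $k\ge 0$ and $\binom{x}{k}=0$ if $k<0$. The $h$-vector of $\mathfrak a$ is $\mathfrak h(\mathfrak a)=(h_0(\mathfrak a),\ldots,h_{d_{\mathfrak a}-1}(\mathfrak a))$, extended to a sequence indexed by $\mathbb{Z}$ by $h_i(\mathfrak a)=0$ for $i<0$ or $i\ge d_{\mathfrak a}$; likewise $\mathfrak h(\mathfrak b)$ with $h_i(\mathfrak b)=0$ for $i<0$ or $i\ge d_{\mathfrak b}$. The Segre product is $\mathfrak a\ast\mathfrak b=(a_nb_n)_{n\ge 0}$. Its generating series can be written as $$\sum_{n\ge 0}a_nb_nt^n=\frac{h_0(\mathfrak a\ast\mathfrak b)+\cdots+h_{d_{\mathfrak a}+d_{\mathfrak b}-2}(\mathfrak a\ast\mathfrak b)t^{d_{\mathfrak a}+d_{\mathfrak b}-2}}{(1-t)^{d_{\mathfrak a}+d_{\mathfrak b}-1}},$$ which defines the numbers $h_n(\mathfrak a\ast\mathfrak b)$; set $h_n(\mathfrak a\ast\mathfrak b)=0$ for $n<0$ or $n\ge d_{\mathfrak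 a}+d_{\mathfrak b}-1$. For a sequence $c=(c_n)_{n\in\mathbb{Z}}$, $n\in\mathbb{Z}$ and a positive integer $d$, $\operatorname{rev}_{n,d}(c):=(c_n,c_{n-1},\ldots,c_{n-d+1})^T$ (a column vector). For a non-negative integer $t$, $M_{d_{\mathfrak a}}(d_{\mathfrak b},t)$ is the $d_{\mathfrak a}\times d_{\mathfrak a}$ matrix $$M_{d_{\mathfrak a}}(d_{\mathfrak b},t):=\left(\binom{d_{\mathfrak a}+i+t-j-1}{i+t}\binom{d_{\mathfrak b}-i-t+j-1}{j}\right)_{0\le i,j\le d_{\mathfrak a}-1}.$$ *)

theory Defs
  imports
    "HOL-Computational_Algebra.Formal_Power_Series"
    "Jordan_Normal_Form.Matrix"
begin

text \<open>
  The \<open>h\<close>-vector depends on the exponent \<open>d\<close> of the denominator, not only on the sequence.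
  It is indexed by the integers and vanishes outside \<open>{0..<d}\<close>.
\<close>

definition is_h_vector :: "nat \<Rightarrow> (nat \<Rightarrow> complex) \<Rightarrow> (int \<Rightarrow> complex) \<Rightarrow> bool" where
  "is_h_vector d c h \<longleftrightarrow>
     Abs_fps c = (\<Sum>i<d. fps_const (h (int i)) * fps_X ^ i) / (1 - fps_X) ^ d \<and>
     (\<forall>i. i < 0 \<or> int d \<le> i \<longrightarrow> h i = 0)"

definition has_h_vector :: "nat \<Rightarrow> (nat \<Rightarrow> complex) \<Rightarrow> bool" where
  "has_h_vector d c \<longleftrightarrow> (\<exists>h. is_h_vector d c h)"

text \<open>
  The description below is meaningful only if \<open>has_h_vector d c\<close>; uniqueness is
  \<open>is_h_vector_unique\<close>, and existence for Segre products is \<open>has_h_vector_segre\<close>.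
\<close>

definition h_vector :: "nat \<Rightarrow> (nat \<Rightarrow> complex) \<Rightarrow> int \<Rightarrow> complex" where
  "h_vector d c = (THE h. is_h_vector d c h)"

definition segre :: "(nat \<Rightarrow> complex) \<Rightarrow> (nat \<Rightarrow> complex) \<Rightarrow> nat \<Rightarrow> complex" where
  "segre a b = (\<lambda>n. a n * b n)"

definition rev_vec :: "int \<Rightarrow> nat \<Rightarrow> (int \<Rightarrow> complex) \<Rightarrow> complex vec" where
  "rev_vec n d c = vec d (\<lambda>k. c (n - int k))"

text \<open>
  The lower indices \<open>i + t\<close> and \<open>j\<close> are never negative, so \<open>gchoose\<close> covers the binomial
  coefficients that occur. The upper arguments are formed in \<open>int\<close> to avoid truncated
  subtraction.
\<close>

definition segre_mat :: "nat \<Rightarrow> nat \<Rightarrow> nat \<Rightarrow> complex mat" where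
  "segre_mat da db t = mat da da (\<lambda>(i, j).
     (of_int (int da + int i + int t - int j - 1) gchoose (i + t)) *
     (of_int (int db - int i - int t + int j - 1) gchoose j))"


lemma fps_nth_h_numerator:
  "fps_nth (\<Sum>i<d. fps_const (h (int i)) * fps_X ^ i :: complex fps) n =
     (if n < d then h (int n) else 0)"
proof -
  have "fps_nth (\<Sum>i<d. fps_const (h (int i)) * fps_X ^ i :: complex fps) n =
      (\<Sum>i<d. if i = n then h (int i) else 0)"
    unfolding fps_sum_nth by (intro sum.cong) auto
  also have "\<dots> = (if n < d then h (int n) else 0)"
    by (subst sum.delta) auto
  finally show ?thesis .
qed

lemma one_minus_fps_X_power_nth_0:
  "fps_nth ((1 - fps_X) ^ d :: complex fps) 0 \<noteq> 0"
  by (simp add: fps_power_zeroth)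

lemma fps_eq_divide_one_minus_X_power_iff:
  fixes F N :: "complex fps"
  shows "F = N / (1 - fps_X) ^ d \<longleftrightarrow> (1 - fps_X) ^ d * F = N"
proof -
  let ?D = "(1 - fps_X) ^ d :: complex fps"
  have nz: "fps_nth ?D 0 \<noteq> 0" by (rule one_minus_fps_X_power_nth_0)
  have inv: "inverse ?D * ?D = 1" using nz by (rule inverse_mult_eq_1)
  have "N / ?D = N * inverse ?D" using nz by (rule fps_divide_unit)
  moreover have "F = N * inverse ?D \<longleftrightarrow> ?D * F = N"
  proof
    assume "F = N * inverse ?D"
    then have "?D * F = N * (inverse ?D * ?D)" by (simp only: mult_ac)
    then show "?D * F = N" by (simp only: inv mult_1_right)
  next
    assume "?D * F = N"
    then have "N * inverse ?D = (inverse ?D * ?D) * F" by (metis mult.commute mult.assoc)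
    then show "F = N * inverse ?D" by (simp only: inv mult_1_left)
  qed
  ultimately show ?thesis by metis
qed

lemma is_h_vector_unique:
  assumes "is_h_vector d c h" and "is_h_vector d c h'"
  shows "h = h'"
proof
  fix i :: int
  have *: "(\<Sum>i<d. fps_const (h (int i)) * fps_X ^ i) =
      (\<Sum>i<d. fps_const (h' (int i)) * fps_X ^ i)"
    using assms unfolding is_h_vector_def fps_eq_divide_one_minus_X_power_iff by metis
  show "h i = h' i"
  proof (cases "0 \<le> i \<and> i < int d")
    case True
    then obtain n where "i = int n" "n < d" by (metis nat_eq_iff of_nat_less_iff)
    then show ?thesis
      using arg_cong[OF *, of "\<lambda>f. fps_nth f n"] by (simp add: fps_nth_h_numerator)
  next
    case False
    then show ?thesis using assms unfolding is_h_vector_def by (metis not_le)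
  qed
qed

lemma h_vector_eqI: "is_h_vector d c h \<Longrightarrow> h_vector d c = h"
  unfolding h_vector_def by (blast intro: the_equality is_h_vector_unique)

lemma is_h_vector_h_vector: "has_h_vector d c \<Longrightarrow> is_h_vector d c (h_vector d c)"
  unfolding has_h_vector_def using h_vector_eqI by metis

definition fwd_diff :: "(nat \<Rightarrow> complex) \<Rightarrow> nat \<Rightarrow> complex" where
  "fwd_diff c = (\<lambda>n. c (Suc n) - c n)"

lemma fwd_diff_pow_shift:
  "(fwd_diff ^^ d) c (Suc n) = (fwd_diff ^^ d) (\<lambda>n. c (Suc n)) n"
  by (induction d arbitrary: n) (simp_all add: fwd_diff_def)

lemma fwd_diff_pow_add:
  "(fwd_diff ^^ d) (\<lambda>n. f n + g n) = (\<lambda>n. (fwd_diff ^^ d) f n + (fwd_diff ^^ d) g n)"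
  by (induction d) (simp_all add: fwd_diff_def fun_eq_iff algebra_simps)

lemma fwd_diff_pow_mult_eq_0:
  assumes "(fwd_diff ^^ p) a = (\<lambda>_. 0)" and "(fwd_diff ^^ q) b = (\<lambda>_. 0)" and "p + q \<le> Suc s"
  shows "(fwd_diff ^^ s) (\<lambda>n. a n * b n) = (\<lambda>_. 0)"
  using assms
proof (induction s arbitrary: p q a b)
  case 0
  then have "p = 0 \<or> q = 0" by linarith
  then show ?case using 0 by auto
next
  case (Suc s)
  have zero: "(fwd_diff ^^ m) (\<lambda>_. 0) = (\<lambda>_. 0)" for m
    by (induction m) (simp_all add: fwd_diff_def)
  show ?case
  proof (cases "p = 0 \<or> q = 0")
    case True
    then have "(\<lambda>n. a n * b n) = (\<lambda>_. 0)" using Suc.prems by auto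
    then show ?thesis by (simp only: zero)
  next
    case False
    then obtain p' q' where pq: "p = Suc p'" "q = Suc q'" by (metis not0_implies_Suc)
    have "(fwd_diff ^^ p') (fwd_diff a) = (\<lambda>_. 0)" "(fwd_diff ^^ q') (fwd_diff b) = (\<lambda>_. 0)"
      using Suc.prems(1,2) unfolding pq funpow_Suc_right by simp_all
    moreover have "(fwd_diff ^^ q) (\<lambda>n. b (Suc n)) = (\<lambda>_. 0)"
      using Suc.prems(2) by (intro ext) (simp flip: fwd_diff_pow_shift)
    ultimately have "(fwd_diff ^^ s) (\<lambda>n. fwd_diff a n * b (Suc n)) = (\<lambda>_. 0)"
      "(fwd_diff ^^ s) (\<lambda>n. a n * fwd_diff b n) = (\<lambda>_. 0)"
      using Suc.IH[of p' "fwd_diff a" q "\<lambda>n. b (Suc n)"] Suc.IH[of p a q' "fwd_diff b"]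
        Suc.prems(1,3) pq(1,2) by (simp_all del: funpow.simps)
    moreover have "fwd_diff (\<lambda>n. a n * b n) =
        (\<lambda>n. fwd_diff a n * b (Suc n) + a n * fwd_diff b n)"
      by (auto simp: fwd_diff_def algebra_simps)
    ultimately show ?thesis
      unfolding funpow_Suc_right o_def by (simp add: fwd_diff_pow_add)
  qed
qed

lemma fps_nth_one_minus_X_power_mult:
  "fps_nth ((1 - fps_X) ^ d * Abs_fps c) (n + d) = (fwd_diff ^^ d) c n"
proof (induction d arbitrary: c n)
  case 0
  show ?case by simp
next
  case (Suc d)
  define c' where "c' m = (if m = 0 then c 0 else c m - c (m - 1))" for m
  have c': "(1 - fps_X) * Abs_fps c = Abs_fps c'"
    by (rule fps_ext) (simp add: c'_def left_diff_distrib)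
  have "fps_nth ((1 - fps_X) ^ Suc d * Abs_fps c) (n + Suc d) =
      fps_nth ((1 - fps_X) ^ d * Abs_fps c') (Suc n + d)"
    by (simp add: power_Suc2 mult.assoc c' del: power_Suc)
  also have "\<dots> = (fwd_diff ^^ d) (\<lambda>n. c' (Suc n)) n"
    unfolding Suc.IH fwd_diff_pow_shift ..
  also have "(\<lambda>n. c' (Suc n)) = fwd_diff c"
    by (simp add: c'_def fwd_diff_def)
  finally show ?case by (simp add: funpow_swap1)
qed

lemma has_h_vector_iff_fwd_diff:
  "has_h_vector d c \<longleftrightarrow> (fwd_diff ^^ d) c = (\<lambda>_. 0)"
proof
  assume "has_h_vector d c"
  then obtain h where
    "(1 - fps_X) ^ d * Abs_fps c = (\<Sum>i<d. fps_const (h (int i)) * fps_X ^ i)"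
    unfolding has_h_vector_def is_h_vector_def fps_eq_divide_one_minus_X_power_iff by blast
  then show "(fwd_diff ^^ d) c = (\<lambda>_. 0)"
    by (intro ext) (simp flip: fps_nth_one_minus_X_power_mult add: fps_nth_h_numerator)
next
  assume *: "(fwd_diff ^^ d) c = (\<lambda>_. 0)"
  define h where "h i = (if 0 \<le> i \<and> i < int d
    then fps_nth ((1 - fps_X) ^ d * Abs_fps c) (nat i) else 0)" for i
  have "fps_nth ((1 - fps_X) ^ d * Abs_fps c) n = 0" if "d \<le> n" for n
    using fps_nth_one_minus_X_power_mult[of d c "n - d"] * that by simp
  then have "(1 - fps_X) ^ d * Abs_fps c = (\<Sum>i<d. fps_const (h (int i)) * fps_X ^ i)"
    by (intro fps_ext) (simp only: fps_nth_h_numerator, simp add: h_def)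
  then have "is_h_vector d c h"
    unfolding is_h_vector_def fps_eq_divide_one_minus_X_power_iff by (auto simp: h_def)
  then show "has_h_vector d c" unfolding has_h_vector_def by blast
qed

lemma has_h_vector_segre:
  assumes "has_h_vector da a" and "has_h_vector db b"
  shows "has_h_vector (da + db - 1) (segre a b)"
  using assms unfolding has_h_vector_iff_fwd_diff segre_def
  by (rule fwd_diff_pow_mult_eq_0) simp

end

theory Submission
  imports Defs
begin

text \<open>
  Put \<open>A = da - 1\<close> and \<open>B = db - 1\<close>. By bilinearity it suffices to treat the numerators \<open>t ^ p\<close>
  and \<open>t ^ q\<close>, for which \<open>a\<^sub>m = (m + A - p choose A)\<close> and \<open>b\<^sub>m = (m + B - q choose B)\<close>. Nanjundiah's
  identity expands the product \<open>a\<^sub>m b\<^sub>m\<close> in the binomials \<open>(m + A + B - n choose A + B)\<close>, the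
  coefficient at \<open>n\<close> being \<open>(A + q - p choose n - p) (B + p - q choose n - q)\<close>. Hence
  \<open>h\<^sub>n(a * b)\<close> is the sum over all \<open>p \<le> A\<close>, \<open>q \<le> B\<close> of \<open>h\<^sub>p(a) h\<^sub>q(b)\<close> times this coefficient,
  and the substitution \<open>p = n - t - i\<close>, \<open>q = n - j\<close> turns it into the matrix product. The three
  cases \<open>t = 0\<close>, \<open>t = n - A\<close>, \<open>t = B - A\<close> only select a window of indices containing
  all non-zero terms.
\<close>

section \<open>Binomial identities: Vandermonde convolution and Nanjundiah's identity\<close>

lemma choose_mult_choose:
  fixes n m k :: nat
  assumes "k \<le> m"
  shows "(n choose m) * (m choose k) = (n choose k) * ((n - k) choose (m - k))"
proof (cases "m \<le> n")
  case True
  then show ?thesis using assms by (rule choose_mult[rotated])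
next
  case False
  then have "n < k \<or> n - k < m - k" using assms by linarith
  then show ?thesis using False by (auto simp: binomial_eq_0)
qed

text \<open>Trinomial revision moves \<open>M choose j\<close> out of the sum, and Vandermonde
  evaluates what is left. For \<open>j > M\<close> the truncated \<open>M - j\<close> is harmless,
  because \<open>M choose j\<close> vanishes.\<close>

lemma sum_choose_choose_choose:
  fixes M N B j :: nat
  assumes "j \<le> B"
  shows "(\<Sum>k\<le>B. (M choose k) * (k choose j) * (N choose (B - k))) =
    (M choose j) * ((M - j + N) choose (B - j))"
proof -
  have "(\<Sum>k\<le>B. (M choose k) * (k choose j) * (N choose (B - k))) =
      (\<Sum>k\<in>{j..B}. (M choose k) * (k choose j) * (N choose (B - k)))"
    by (rule sum.mono_neutral_right) (auto simp: binomial_eq_0)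
  also have "\<dots> = (\<Sum>k\<in>{j..B}. (M choose j) * (((M - j) choose (k - j)) * (N choose (B - k))))"
    by (intro sum.cong) (simp_all add: choose_mult_choose)
  also have "\<dots> = (\<Sum>l\<le>B - j. (M choose j) * (((M - j) choose l) * (N choose (B - j - l))))"
    using assms
    by (intro sum.reindex_bij_witness[where i = "\<lambda>l. l + j" and j = "\<lambda>k. k - j"]) auto
  also have "\<dots> = (M choose j) * ((M - j + N) choose (B - j))"
    by (simp only: vandermonde flip: sum_distrib_left)
  finally show ?thesis .
qed

text \<open>Vandermonde splits \<open>(x + k) choose (A + B)\<close> over \<open>j\<close>. After
  exchanging the sums, the inner sum over \<open>k\<close> is
  \<open>sum_choose_choose_choose\<close>; trinomial revision then frees the factor
  \<open>x choose A\<close>, and one more Vandermonde sum gives \<open>y choose B\<close>.\<close>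

lemma nanjundiah:
  fixes A B M N x y :: nat
  assumes MN: "M + N = A + B" and xy: "x + M = y + A"
  shows "(\<Sum>k\<le>B. (M choose k) * (N choose (B - k)) * ((x + k) choose (A + B))) =
    (x choose A) * (y choose B)"
proof -
  \<comment> \<open>Terms with \<open>j > k\<close> vanish, so the range can end at
    \<open>B\<close>. This bound does not depend on \<open>k\<close>, which permits
    \<open>sum.swap\<close>.\<close>
  have expand: "(x + k) choose (A + B) = (\<Sum>j\<le>B. (k choose j) * (x choose (A + B - j)))"
    if "k \<le> B" for k
  proof -
    have "(x + k) choose (A + B) = (\<Sum>j\<le>A + B. (k choose j) * (x choose (A + B - j)))"
      by (simp add: vandermonde add.commute)
    also have "\<dots> = (\<Sum>j\<le>B. (k choose j) * (x choose (A + B - j)))"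
      using that by (intro sum.mono_neutral_right) (auto simp: binomial_eq_0)
    finally show ?thesis .
  qed
  have "(\<Sum>k\<le>B. (M choose k) * (N choose (B - k)) * ((x + k) choose (A + B))) =
      (\<Sum>k\<le>B. \<Sum>j\<le>B. (x choose (A + B - j)) * ((M choose k) * (k choose j) * (N choose (B - k))))"
    by (intro sum.cong refl) (simp add: expand sum_distrib_left mult_ac)
  also have "\<dots> =
      (\<Sum>j\<le>B. \<Sum>k\<le>B. (x choose (A + B - j)) * ((M choose k) * (k choose j) * (N choose (B - k))))"
    by (rule sum.swap)
  also have "\<dots> =
      (\<Sum>j\<le>B. (x choose (A + B - j)) * ((M choose j) * ((M - j + N) choose (B - j))))"
    by (intro sum.cong refl) (simp flip: sum_distrib_left add: sum_choose_choose_choose)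
  also have "\<dots> = (\<Sum>j\<le>B. (x choose A) * ((M choose j) * ((x - A) choose (B - j))))"
  proof (intro sum.cong refl)
    fix j assume "j \<in> {..B}"
    then have j: "j \<le> B" by simp
    show "(x choose (A + B - j)) * ((M choose j) * ((M - j + N) choose (B - j))) =
        (x choose A) * ((M choose j) * ((x - A) choose (B - j)))"
    proof (cases "j \<le> M")
      case True
      then have "M - j + N = A + B - j" using MN by simp
      moreover have "(A + B - j) choose (B - j) = (A + B - j) choose A"
        using j binomial_symmetric[of "B - j" "A + B - j"] by simp
      moreover have "(x choose (A + B - j)) * ((A + B - j) choose A) =
          (x choose A) * ((x - A) choose (B - j))"
        using j choose_mult_choose[of A "A + B - j" x] by simp
      ultimately show ?thesis by (metis mult.assoc mult.commute)
    qed (simp add: binomial_eq_0)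
  qed
  also have "\<dots> = (x choose A) * ((M + (x - A)) choose B)"
    by (simp flip: sum_distrib_left add: vandermonde)
  also have "\<dots> = (x choose A) * (y choose B)"
  proof (cases "A \<le> x")
    case True
    then have "M + (x - A) = y" using xy by simp
    then show ?thesis by simp
  qed (simp add: binomial_eq_0)
  finally show ?thesis .
qed

section \<open>Values of a sequence in terms of its h-vector\<close>

text \<open>By Pascal's rule, one factor \<open>1 - fps_X\<close> lowers \<open>A\<close> by
  one.\<close>

lemma one_minus_fps_X_power_mult_choose:
  "(1 - fps_X) ^ Suc A * Abs_fps (\<lambda>n. of_nat ((n + A) choose A)) = (1 :: complex fps)"
proof (induction A)
  case 0
  show ?case by (rule fps_ext) (simp add: left_diff_distrib)
next
  case (Suc A)
  have "(1 - fps_X) * Abs_fps (\<lambda>n. of_nat ((n + Suc A) choose Suc A)) =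
      (Abs_fps (\<lambda>n. of_nat ((n + A) choose A)) :: complex fps)"
  proof (rule fps_ext)
    fix n
    show "fps_nth ((1 - fps_X) * Abs_fps (\<lambda>n. of_nat ((n + Suc A) choose Suc A))) n =
        fps_nth (Abs_fps (\<lambda>n. of_nat ((n + A) choose A)) :: complex fps) n"
      by (cases n) (simp_all add: left_diff_distrib)
  qed
  then show ?case using Suc.IH by (simp only: power_Suc2 mult.assoc)
qed

text \<open>Replaces power series by a pointwise expansion, so that an h-vector can be read off from
  binomial coefficients. All \<open>p \<le> A\<close> may be summed, since the binomial vanishes for
  \<open>m < p \<le> A\<close>.\<close>

lemma is_h_vector_Suc_iff:
  "is_h_vector (Suc A) c h \<longleftrightarrow>
    (\<forall>m. c m = (\<Sum>p\<le>A. h (int p) * of_nat ((m + A - p) choose A))) \<and>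
    (\<forall>i. i < 0 \<or> int A < i \<longrightarrow> h i = 0)"
proof -
  let ?D = "(1 - fps_X) ^ Suc A :: complex fps"
  let ?N = "\<Sum>i<Suc A. fps_const (h (int i)) * fps_X ^ i"
  let ?G = "Abs_fps (\<lambda>n. of_nat ((n + A) choose A)) :: complex fps"
  have DG: "?D * ?G = 1" by (rule one_minus_fps_X_power_mult_choose)
  have "fps_nth (?N * ?G) m = (\<Sum>p\<le>A. h (int p) * of_nat ((m + A - p) choose A))" for m
    unfolding fps_mult_nth fps_nth_h_numerator
    by (rule sum.mono_neutral_cong) (auto simp: binomial_eq_0)
  moreover have "?D * Abs_fps c = ?N \<longleftrightarrow> Abs_fps c = ?N * ?G"
  proof
    assume *: "?D * Abs_fps c = ?N"
    have "Abs_fps c = (?D * ?G) * Abs_fps c" by (simp only: DG mult_1_left)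
    also have "\<dots> = (?D * Abs_fps c) * ?G" by (simp only: mult_ac)
    finally show "Abs_fps c = ?N * ?G" unfolding * .
  next
    assume *: "Abs_fps c = ?N * ?G"
    have "?D * (?N * ?G) = ?N * (?D * ?G)" by (rule mult.left_commute)
    then show "?D * Abs_fps c = ?N" unfolding * DG mult_1_right .
  qed
  ultimately have "?D * Abs_fps c = ?N \<longleftrightarrow>
      (\<forall>m. c m = (\<Sum>p\<le>A. h (int p) * of_nat ((m + A - p) choose A)))"
    by (simp add: fps_eq_iff)
  moreover have "int (Suc A) \<le> i \<longleftrightarrow> int A < i" for i by auto
  ultimately show ?thesis
    unfolding is_h_vector_def fps_eq_divide_one_minus_X_power_iff by simp
qed

section \<open>The h-vector of a Segre product\<close>

text \<open>The guard is needed because a truncated \<open>n - p\<close> or \<open>n - q\<close>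
  would be \<open>0\<close> and its binomial \<open>1\<close> instead of \<open>0\<close>.\<close>

definition segre_coeff :: "nat \<Rightarrow> nat \<Rightarrow> nat \<Rightarrow> nat \<Rightarrow> nat \<Rightarrow> nat" where
  "segre_coeff A B p q n = (if p \<le> n \<and> q \<le> n
     then ((A + q - p) choose (n - p)) * ((B + p - q) choose (n - q)) else 0)"

lemma segre_coeff_eq_0:
  assumes "p \<le> A" and "q \<le> B" and "A + q < n \<or> B + p < n"
  shows "segre_coeff A B p q n = 0"
  using assms by (auto simp: segre_coeff_def binomial_eq_0)

text \<open>This is \<open>nanjundiah\<close> at \<open>x = m + A - p\<close> and
  \<open>y = m + B - q\<close>, with summation index \<open>k = B + p - n\<close>.\<close>

lemma sum_segre_coeff_choose:
  assumes p: "p \<le> A" and q: "q \<le> B"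
  shows "(\<Sum>n\<le>A + B. segre_coeff A B p q n * ((m + (A + B) - n) choose (A + B))) =
    ((m + A - p) choose A) * ((m + B - q) choose B)"
proof -
  let ?M = "B + p - q" and ?N = "A + q - p"
  have "(\<Sum>n\<le>A + B. segre_coeff A B p q n * ((m + (A + B) - n) choose (A + B))) =
      (\<Sum>n\<in>{p..B + p}. segre_coeff A B p q n * ((m + (A + B) - n) choose (A + B)))"
    using p q by (intro sum.mono_neutral_right) (auto simp: segre_coeff_def binomial_eq_0)
  also have "\<dots> =
      (\<Sum>k\<le>B. (?M choose k) * (?N choose (B - k)) * ((m + A - p + k) choose (A + B)))"
  proof (rule sum.reindex_bij_witness[where i = "\<lambda>k. B + p - k" and j = "\<lambda>n. B + p - n"])
    fix n assume "n \<in> {p..B + p}"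
    then have n: "p \<le> n" "n \<le> B + p" by auto
    have "m + A - p + (B + p - n) = m + (A + B) - n" "B - (B + p - n) = n - p"
      using n p by auto
    moreover have "(?M choose (B + p - n)) * (?N choose (n - p)) = segre_coeff A B p q n"
    proof (cases "q \<le> n")
      case True
      then have "?M choose (n - q) = ?M choose (B + p - n)"
        using n q binomial_symmetric[of "n - q" ?M] by simp
      then show ?thesis using True n by (simp add: segre_coeff_def)
    next
      \<comment> \<open>For \<open>n < q\<close> the reflected lower index exceeds
        \<open>?M\<close>, so the binomial is zero, in agreement with the guard.\<close>
      case False
      then have "?M < B + p - n" using n q by linarith
      then show ?thesis using False by (simp add: segre_coeff_def binomial_eq_0)
    qed
    ultimately show "(?M choose (B + p - n)) * (?N choose (B - (B + p - n))) *
        ((m + A - p + (B + p - n)) choose (A + B)) =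
        segre_coeff A B p q n * ((m + (A + B) - n) choose (A + B))" by (simp only:)
  qed auto
  also have "\<dots> = ((m + A - p) choose A) * ((m + B - q) choose B)"
    using p q by (intro nanjundiah) auto
  finally show ?thesis .
qed

text \<open>Multiply the expansions of \<open>a\<close> and \<open>b\<close>, expand each product of
  binomials by \<open>sum_segre_coeff_choose\<close>, and collect by \<open>n\<close>. The case
  \<open>i < 0\<close> is separate because \<open>nat i\<close> would be \<open>0\<close>
  there.\<close>

lemma is_h_vector_segre:
  assumes a: "is_h_vector (Suc A) a f" and b: "is_h_vector (Suc B) b g"
  shows "is_h_vector (Suc (A + B)) (segre a b) (\<lambda>i. if i < 0 then 0 else
    \<Sum>(p, q)\<in>{..A} \<times> {..B}. f (int p) * g (int q) * of_nat (segre_coeff A B p q (nat i)))"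
    (is "is_h_vector _ _ ?h")
  unfolding is_h_vector_Suc_iff
proof (intro conjI allI impI)
  fix m
  have "segre a b m = (\<Sum>p\<le>A. f (int p) * of_nat ((m + A - p) choose A)) *
      (\<Sum>q\<le>B. g (int q) * of_nat ((m + B - q) choose B))"
    using a b unfolding is_h_vector_Suc_iff segre_def by simp
  also have "\<dots> = (\<Sum>(p, q)\<in>{..A} \<times> {..B}. f (int p) * g (int q) *
      of_nat (((m + A - p) choose A) * ((m + B - q) choose B)))"
    by (simp add: sum_product sum.cartesian_product mult_ac)
  also have "\<dots> = (\<Sum>(p, q)\<in>{..A} \<times> {..B}. \<Sum>n\<le>A + B. f (int p) * g (int q) *
      of_nat (segre_coeff A B p q n) * of_nat ((m + (A + B) - n) choose (A + B)))"
    by (intro sum.cong refl)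
      (auto simp: sum_segre_coeff_choose mult.assoc simp flip: sum_distrib_left of_nat_mult of_nat_sum)
  also have "\<dots> = (\<Sum>n\<le>A + B. ?h (int n) * of_nat ((m + (A + B) - n) choose (A + B)))"
    by (simp add: case_prod_unfold sum_distrib_right) (rule sum.swap)
  finally show "segre a b m =
      (\<Sum>n\<le>A + B. ?h (int n) * of_nat ((m + (A + B) - n) choose (A + B)))" .
next
  fix i :: int assume i: "i < 0 \<or> int (A + B) < i"
  have "segre_coeff A B p q (nat i) = 0" if "0 \<le> i" "p \<le> A" "q \<le> B" for p q
    using that i by (intro segre_coeff_eq_0) linarith+
  then show "?h i = 0"
    by (auto intro!: sum.neutral)
qed

section \<open>The matrix product as a window of the double sum\<close>

text \<open>The matrix product sees only \<open>n - t - A \<le> p \<le> n - t\<close> and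
  \<open>n - A \<le> q \<le> n\<close>. The assumption \<open>upper\<close> leaves only zero terms
  with \<open>p > n - t\<close>, and \<open>lower\<close> does the same for
  \<open>p < n - t - A\<close>; terms with \<open>q\<close> outside its window always
  vanish.\<close>

lemma rev_vec_segre_mat_rev_vec:
  assumes f: "\<And>i. i < 0 \<or> int A < i \<Longrightarrow> f i = 0"
    and g: "\<And>i. i < 0 \<or> int B < i \<Longrightarrow> g i = 0"
    and lower: "n \<le> A + t \<or> t + A = B \<and> B \<le> n"
    and upper: "t = 0 \<or> A + t \<le> n"
  shows "rev_vec (int n - int t) (Suc A) f \<bullet>
      (segre_mat (Suc A) (Suc B) t *\<^sub>v rev_vec (int n) (Suc A) g) =
    (\<Sum>(p, q)\<in>{..A} \<times> {..B}. f (int p) * g (int q) * of_nat (segre_coeff A B p q n))"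
proof -
  define G :: "nat \<Rightarrow> nat \<Rightarrow> complex" where "G i j =
    (of_int (int (Suc A) + int i + int t - int j - 1) gchoose (i + t)) *
    (of_int (int (Suc B) - int i - int t + int j - 1) gchoose j)" for i j
  define F where "F = (\<lambda>(i, j). f (int n - int t - int i) * g (int n - int j) * G i j)"
  define K where "K = (\<lambda>(p, q). f (int p) * g (int q) * of_nat (segre_coeff A B p q n))"
  \<comment> \<open>\<open>I\<close> and \<open>P\<close> describe the same terms, those with both
    index pairs in range, in matrix and in h-vector coordinates. On them every natural subtraction
    is exact.\<close>
  define I where
    "I = {(i, j) \<in> {..A} \<times> {..A}. t + i \<le> n \<and> n \<le> A + t + i \<and> j \<le> n \<and> n \<le> B + j}"
  define P where
    "P = {(p, q) \<in> {..A} \<times> {..B}. t + p \<le> n \<and> n \<le> A + t + p \<and> q \<le> n \<and> n \<le> A + q}"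
  have "rev_vec (int n - int t) (Suc A) f \<bullet>
      (segre_mat (Suc A) (Suc B) t *\<^sub>v rev_vec (int n) (Suc A) g) =
      (\<Sum>i\<le>A. \<Sum>j\<le>A. F (i, j))"
    unfolding scalar_prod_def rev_vec_def segre_mat_def F_def G_def
    by (auto simp: scalar_prod_def sum_distrib_left mult_ac atLeast0LessThan lessThan_Suc_atMost
        intro!: sum.cong)
  also have "\<dots> = (\<Sum>ij\<in>{..A} \<times> {..A}. F ij)"
    by (simp add: sum.cartesian_product)
  also have "\<dots> = (\<Sum>ij\<in>I. F ij)"
  proof (rule sum.mono_neutral_right)
    show "\<forall>ij\<in>{..A} \<times> {..A} - I. F ij = 0"
    proof
      fix ij assume *: "ij \<in> {..A} \<times> {..A} - I"
      obtain i j where ij: "ij = (i, j)" by fastforce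
      have "int n - int t - int i < 0 \<or> int A < int n - int t - int i \<or>
          int n - int j < 0 \<or> int B < int n - int j"
        using * ij by (auto simp: I_def)
      then have "f (int n - int t - int i) = 0 \<or> g (int n - int j) = 0"
        using f g by blast
      then show "F ij = 0" by (auto simp: F_def ij)
    qed
  qed (auto simp: I_def)
  also have "\<dots> = (\<Sum>pq\<in>P. K pq)"
  proof (rule sum.reindex_bij_witness[where
        i = "\<lambda>(p, q). (n - t - p, n - q)" and j = "\<lambda>(i, j). (n - t - i, n - j)"])
    fix ij assume *: "ij \<in> I"
    obtain i j where ij: "ij = (i, j)" by fastforce
    define p q where "p = n - t - i" and "q = n - j"
    have b: "t + i \<le> n" "n \<le> A + t + i" "j \<le> n" "n \<le> B + j" "i \<le> A" "j \<le> A"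
      using * ij by (auto simp: I_def)
    have p: "p \<le> A" "p \<le> n" "n - p = i + t" "int n - int t - int i = int p"
      and q: "q \<le> B" "q \<le> n" "n - q = j" "int n - int j = int q"
      using b by (auto simp: p_def q_def)
    \<comment> \<open>Since \<open>i + t = n - p\<close> and \<open>j = n - q\<close>, the upper
      arguments become natural numbers and \<open>gchoose\<close> is the ordinary binomial.\<close>
    have e: "int (Suc A) + int i + int t - int j - 1 = int (A + q - p)"
      "int (Suc B) - int i - int t + int j - 1 = int (B + p - q)"
      using p q b by (auto simp: p_def q_def of_nat_diff)
    have "G i j = of_nat (segre_coeff A B p q n)"
      unfolding G_def e segre_coeff_def using p q by (simp add: binomial_gbinomial)
    then show "K (case ij of (i, j) \<Rightarrow> (n - t - i, n - j)) = F ij"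
      unfolding ij F_def K_def prod.case p_def[symmetric] q_def[symmetric] p(4) q(4) by simp
  qed (auto simp: I_def P_def)
  also have "\<dots> = (\<Sum>pq\<in>{..A} \<times> {..B}. K pq)"
  proof (rule sum.mono_neutral_left)
    show "\<forall>pq\<in>{..A} \<times> {..B} - P. K pq = 0"
    proof
      fix pq assume *: "pq \<in> {..A} \<times> {..B} - P"
      obtain p q where pq: "pq = (p, q)" by fastforce
      have bounds: "p \<le> A" "q \<le> B" using * pq by auto
      have "n < t + p \<or> A + t + p < n \<or> n < q \<or> A + q < n"
        using * pq by (auto simp: P_def)
      then consider "n < p \<or> n < q" | "A + q < n \<or> B + p < n"
        using lower upper bounds by linarith
      then have "segre_coeff A B p q n = 0"
      proof cases
        case 1
        then show ?thesis by (auto simp: segre_coeff_def)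
      qed (rule segre_coeff_eq_0[OF bounds])
      then show "K pq = 0" by (simp add: K_def pq)
    qed
  qed (auto simp: P_def)
  finally show ?thesis by (simp add: K_def)
qed

theorem theorem1:
  fixes da db :: nat and a b :: "nat \<Rightarrow> complex" and n :: int
  assumes "0 < da" and "0 < db"
    and "has_h_vector da a" and "has_h_vector db b"
    and "da \<le> db"
  shows
    "(0 \<le> n \<and> n \<le> int da - 1 \<longrightarrow>
        h_vector (da + db - 1) (segre a b) n =
          rev_vec n da (h_vector da a) \<bullet>
            (segre_mat da db 0 *\<^sub>v rev_vec n da (h_vector db b))) \<and>
     (int da \<le> n \<and> n \<le> int db - 1 \<longrightarrow>
        h_vector (da + db - 1) (segre a b) n =
          rev_vec (int da - 1) da (h_vector da a) \<bullet>
            (segre_mat da db (nat (n - int da + 1)) *\<^sub>v rev_vec n da (h_vector db b))) \<and>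
     (int db \<le> n \<and> n \<le> int da + int db - 1 \<longrightarrow>
        h_vector (da + db - 1) (segre a b) n =
          rev_vec (n - int db + int da) da (h_vector da a) \<bullet>
            (segre_mat da db (db - da) *\<^sub>v rev_vec n da (h_vector db b)))"
proof -
  obtain A B where d: "da = Suc A" "db = Suc B"
    using assms(1,2) by (metis gr0_implies_Suc)
  have AB: "A \<le> B" using assms(5) d by simp
  let ?f = "h_vector da a" and ?g = "h_vector db b"
  have f: "is_h_vector (Suc A) a ?f" and g: "is_h_vector (Suc B) b ?g"
    using assms(3,4) d is_h_vector_h_vector by auto
  have window: "h_vector (da + db - 1) (segre a b) (int k) =
      rev_vec (int k - int t) da ?f \<bullet> (segre_mat da db t *\<^sub>v rev_vec (int k) da ?g)"
    if "k \<le> A + t \<or> t + A = B \<and> B \<le> k" "t = 0 \<or> A + t \<le> k" for k t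
  proof -
    have "rev_vec (int k - int t) (Suc A) ?f \<bullet>
        (segre_mat (Suc A) (Suc B) t *\<^sub>v rev_vec (int k) (Suc A) ?g) =
        (\<Sum>(p, q)\<in>{..A} \<times> {..B}. ?f (int p) * ?g (int q) * of_nat (segre_coeff A B p q k))"
      using f g that unfolding is_h_vector_Suc_iff
      by (intro rev_vec_segre_mat_rev_vec) blast+
    then show ?thesis
      using h_vector_eqI[OF is_h_vector_segre[OF f g]] by (simp add: d)
  qed
  show ?thesis
  proof (cases "0 \<le> n")
    case True
    then obtain k where n: "n = int k" by (metis nonneg_int_cases)
    show ?thesis
    proof (intro conjI impI; elim conjE)
      assume "n \<le> int da - 1"
      then show "h_vector (da + db - 1) (segre a b) n = rev_vec n da ?f \<bullet>
          (segre_mat da db 0 *\<^sub>v rev_vec n da ?g)"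
        using window[of k 0] by (simp add: n d)
    next
      assume "int da \<le> n" and "n \<le> int db - 1"
      \<comment> \<open>For \<open>t = k - A\<close> both window conditions hold with equality,
        \<open>A + t = k\<close>.\<close>
      moreover from this have "int k - int (k - A) = int da - 1" "nat (n - int da + 1) = k - A"
        by (simp_all add: n d)
      ultimately show "h_vector (da + db - 1) (segre a b) n = rev_vec (int da - 1) da ?f \<bullet>
          (segre_mat da db (nat (n - int da + 1)) *\<^sub>v rev_vec n da ?g)"
        using window[of k "k - A"] by (simp add: n d)
    next
      \<comment> \<open>Here \<open>A + t = B \<le> k\<close>. The endpoint
        \<open>n = da + db - 1\<close> lies one past the last index of the h-vector, so the identity
        there concerns its extension by zero.\<close>
      assume "int db \<le> n"
      then have "h_vector (da + db - 1) (segre a b) (int k) =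
          rev_vec (int k - int (db - da)) da ?f \<bullet>
          (segre_mat da db (db - da) *\<^sub>v rev_vec (int k) da ?g)"
        using AB by (intro window) (auto simp: n d)
      moreover have "int k - int (db - da) = n - int db + int da"
        using assms(5) by (simp add: n of_nat_diff)
      ultimately show "h_vector (da + db - 1) (segre a b) n =
          rev_vec (n - int db + int da) da ?f \<bullet>
          (segre_mat da db (db - da) *\<^sub>v rev_vec n da ?g)"
        by (simp only: n)
    qed
  qed (use d in auto)
qed

end
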